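(* Let $G$ be a simple graph of order $n\geq 6$ that does not contain $\theta(1,2,3)$ as a subgraph. Then $q(G)\leq q(S_{n,2})$, with equality if and only if $G\cong S_{n,2}$.
   Context: All graphs are finite and simple. For a graph $G$, $Q(G)=D(G)+A(G)$ is its signless Laplacian matrix, where $D(G)$ is the diagonal matrix of vertex degrees and $A(G)$ the adjacency matrix; $q(G)$ denotes the largest eigenvalue of $Q(G)$. The theta graph $\theta(l_{1},l_{2},l_{3})$ consists of two vertices joined by three internally vertex-disjoint paths of lengths $l_{1},l_{2},l_{3}$. $S_{n,k}$ denotes the graph on $n$ vertices obtained by joining every vertex of a complete graph $K_{k}$ to each of $n-k$ further isolated (mutually nonadjacent) vertices; so $S_{n,2}=K_2\vee \overline{K_{n-2}}$. *)

theory Defs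
  imports
    "Jordan_Normal_Form.Spectral_Radius"
    "Graph_Theory.Graph_Theory"
begin

text \<open>
  A finite simple graph is a \<open>pair_graph\<close> of the Graph_Theory library: a finite vertex set with a
  symmetric, irreflexive set of vertex pairs as arcs, so that each undirected edge appears as two
  opposite arcs.  The degree of a vertex is therefore its out-degree.
\<close>

section \<open>Signless Laplacian\<close>

text \<open>
  Matrices have rows and columns indexed by \<open>{0..<dim}\<close>, so the matrices of a graph are taken with
  respect to a list \<open>vs\<close> that enumerates its vertices without repetition.
\<close>

definition degree_mat :: "'a pair_pre_digraph \<Rightarrow> 'a list \<Rightarrow> real mat" where
  "degree_mat G vs = mat (length vs) (length vs)
     (\<lambda>(i, j). if i = j then real (out_degree (with_proj G) (vs ! i)) else 0)"

definition adjacency_mat :: "'a pair_pre_digraph \<Rightarrow> 'a list \<Rightarrow> real mat" where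
  "adjacency_mat G vs = mat (length vs) (length vs)
     (\<lambda>(i, j). if (vs ! i, vs ! j) \<in> parcs G then 1 else 0)"

definition signless_laplacian :: "'a pair_pre_digraph \<Rightarrow> 'a list \<Rightarrow> real mat" where
  "signless_laplacian G vs = degree_mat G vs + adjacency_mat G vs"

text \<open>
  The choice of enumeration is immaterial, see \<open>eigenvalue_signless_laplacian_enum\<close> below.
\<close>

definition vertex_enum :: "'a pair_pre_digraph \<Rightarrow> 'a list" where
  "vertex_enum G = (SOME vs. distinct vs \<and> set vs = pverts G)"

definition signless_radius :: "'a pair_pre_digraph \<Rightarrow> real" where
  "signless_radius G = Max {k. eigenvalue (signless_laplacian G (vertex_enum G)) k}"


section \<open>Theta graphs and subgraph containment\<close>

datatype theta_vertex = Source | Sink | Inner nat nat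

text \<open>
  \<open>theta_at l i j\<close> is the vertex at distance \<open>j\<close> from \<open>Source\<close> on the \<open>i\<close>-th path, which has
  length \<open>l i\<close>.  As usual the lengths are supposed to be positive, at most one of them being \<open>1\<close>
  (two paths of length \<open>1\<close> would share their edge).
\<close>

definition theta_at :: "(nat \<Rightarrow> nat) \<Rightarrow> nat \<Rightarrow> nat \<Rightarrow> theta_vertex" where
  "theta_at l i j = (if j = 0 then Source else if j = l i then Sink else Inner i j)"

definition theta_graph :: "nat \<Rightarrow> nat \<Rightarrow> nat \<Rightarrow> theta_vertex pair_pre_digraph" where
  "theta_graph l1 l2 l3 = (let l = (\<lambda>i. [l1, l2, l3] ! i) in
     \<lparr> pverts = {theta_at l i j | i j. i < 3 \<and> j \<le> l i},
       parcs = {(theta_at l i j, theta_at l i (Suc j)) | i j. i < 3 \<and> j < l i} \<union>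
               {(theta_at l i (Suc j), theta_at l i j) | i j. i < 3 \<and> j < l i} \<rparr>)"

text \<open>Containment is as a subgraph that need not be induced.\<close>

definition contains_subgraph :: "'a pair_pre_digraph \<Rightarrow> 'b pair_pre_digraph \<Rightarrow> bool" where
  "contains_subgraph G F \<longleftrightarrow>
     (\<exists>H :: 'a pair_pre_digraph.
        subgraph (with_proj H) (with_proj G) \<and> digraph_iso (with_proj F) (with_proj H))"


section \<open>The graph \<open>S\<^bsub>n,k\<^esub>\<close>\<close>

text \<open>The vertices of the complete graph are \<open>0, \<dots>, k - 1\<close>.\<close>

definition S_graph :: "nat \<Rightarrow> nat \<Rightarrow> nat pair_pre_digraph" where
  "S_graph n k = \<lparr> pverts = {..<n},
     parcs = {(i, j). i < n \<and> j < n \<and> i \<noteq> j \<and> (i < k \<or> j < k)} \<rparr>"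


section \<open>Basic facts\<close>

lemma pair_graph_S_graph: "pair_graph (S_graph n k)"
proof -
  have "parcs (S_graph n k) \<subseteq> {..<n} \<times> {..<n}" by (auto simp: S_graph_def)
  then have "finite (parcs (S_graph n k))" by (rule finite_subset) simp
  then show ?thesis
    by unfold_locales (auto simp: S_graph_def symmetric_def sym_def)
qed

lemma theta_graph_1_2_3:
  "theta_graph 1 2 3 =
     \<lparr> pverts = {Source, Sink, Inner 1 1, Inner 2 1, Inner 2 2},
       parcs = (let E = {(Source, Sink),
                         (Source, Inner 1 1), (Inner 1 1, Sink),
                         (Source, Inner 2 1), (Inner 2 1, Inner 2 2), (Inner 2 2, Sink)}
                in E \<union> E\<inverse>) \<rparr>"
proof -
  let ?l = "\<lambda>i. [1, 2, 3 :: nat] ! i"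
  have 3: "{..<3 :: nat} = {0, 1, 2}" by auto
  have v: "{f i j | i j. i < 3 \<and> j \<le> ?l i} =
      {f 0 0, f 0 1, f 1 0, f 1 1, f 1 2, f 2 0, f 2 1, f 2 2, f 2 3}"
    for f :: "nat \<Rightarrow> nat \<Rightarrow> 'x"
  proof -
    have "{f i j | i j. i < 3 \<and> j \<le> ?l i} = (\<Union>i\<in>{..<3}. f i ` {..?l i})" by blast
    then show ?thesis unfolding 3 by (simp add: atMost_Suc numeral_eq_Suc insert_commute)
  qed
  have a: "{f i j | i j. i < 3 \<and> j < ?l i} = {f 0 0, f 1 0, f 1 1, f 2 0, f 2 1, f 2 2}"
    for f :: "nat \<Rightarrow> nat \<Rightarrow> 'x"
  proof -
    have "{f i j | i j. i < 3 \<and> j < ?l i} = (\<Union>i\<in>{..<3}. f i ` {..<?l i})" by blast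
    then show ?thesis unfolding 3 by (simp add: lessThan_Suc numeral_eq_Suc insert_commute)
  qed
  show ?thesis
    unfolding theta_graph_def Let_def v a
    by (auto simp: theta_at_def numeral_eq_Suc)
qed

lemma vertex_enum:
  assumes "finite (pverts G)"
  shows "distinct (vertex_enum G)" and "set (vertex_enum G) = pverts G"
proof -
  obtain vs where "set vs = pverts G" "distinct vs"
    using finite_distinct_list[OF assms] by blast
  then have "\<exists>vs. distinct vs \<and> set vs = pverts G" by blast
  then have "distinct (vertex_enum G) \<and> set (vertex_enum G) = pverts G"
    unfolding vertex_enum_def by (rule someI_ex)
  then show "distinct (vertex_enum G)" and "set (vertex_enum G) = pverts G" by auto
qed

lemma signless_laplacian_carrier:
  "signless_laplacian G vs \<in> carrier_mat (length vs) (length vs)"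
  by (auto simp: signless_laplacian_def degree_mat_def adjacency_mat_def)

lemma finite_eigenvalues_signless_laplacian: "finite {k. eigenvalue (signless_laplacian G vs) k}"
  using card_finite_spectrum(1)[OF signless_laplacian_carrier] by (simp add: spectrum_def)

lemma eigenvalue_signless_laplacian_iff:
  assumes vs: "distinct vs" "set vs = V"
  shows "eigenvalue (signless_laplacian G vs) k \<longleftrightarrow>
    (\<exists>x. (\<exists>v\<in>V. x v \<noteq> 0) \<and>
       (\<forall>v\<in>V. real (out_degree (with_proj G) v) * x v +
          (\<Sum>w\<in>V. if (v, w) \<in> parcs G then x w else 0) = k * x v))"
proof -
  let ?n = "length vs" and ?Q = "signless_laplacian G vs"
  let ?d = "\<lambda>v. real (out_degree (with_proj G) v)"
  have bij: "bij_betw (\<lambda>i. vs ! i) {0..<?n} V"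
    using bij_betw_nth[OF vs(1), of "{0..<?n}" V] vs(2) by (auto simp: lessThan_atLeast0)
  have row: "(?Q *\<^sub>v y) $ i =
      ?d (vs ! i) * y $ i + (\<Sum>j\<in>{0..<?n}. if (vs ! i, vs ! j) \<in> parcs G then y $ j else 0)"
    if y: "y \<in> carrier_vec ?n" and i: "i < ?n" for y i
  proof -
    have "(?Q *\<^sub>v y) $ i = (\<Sum>j\<in>{0..<?n}. ?Q $$ (i, j) * y $ j)"
      using y i signless_laplacian_carrier[of G vs] by (auto simp: scalar_prod_def)
    also have "\<dots> = (\<Sum>j\<in>{0..<?n}. (if i = j then ?d (vs ! i) * y $ j else 0) +
        (if (vs ! i, vs ! j) \<in> parcs G then y $ j else 0))"
      using i by (intro sum.cong)
        (auto simp: signless_laplacian_def degree_mat_def adjacency_mat_def algebra_simps)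
    finally show ?thesis using i by (simp add: sum.distrib)
  qed
  have sum: "(\<Sum>j\<in>{0..<?n}. if (v, vs ! j) \<in> parcs G then x (vs ! j) else 0) =
      (\<Sum>w\<in>V. if (v, w) \<in> parcs G then x w else 0)" for v and x :: "'a \<Rightarrow> real"
    using sum.reindex_bij_betw[OF bij, of "\<lambda>w. if (v, w) \<in> parcs G then x w else 0"] by simp
  have ev: "eigenvector ?Q y k \<longleftrightarrow> (\<exists>i<?n. y $ i \<noteq> 0) \<and> (\<forall>i<?n. (?Q *\<^sub>v y) $ i = k * y $ i)"
    if y: "y \<in> carrier_vec ?n" for y
    using y signless_laplacian_carrier[of G vs]
    by (auto simp: eigenvector_def vec_eq_iff)
  show ?thesis (is "_ \<longleftrightarrow> ?R")
  proof
    assume "eigenvalue ?Q k"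
    then obtain y where e: "eigenvector ?Q y k" by (auto simp: eigenvalue_def)
    then have y: "y \<in> carrier_vec ?n"
      using signless_laplacian_carrier[of G vs] by (auto simp: eigenvector_def)
    define x where "x v = y $ the_inv_into {0..<?n} (\<lambda>i. vs ! i) v" for v
    have x: "x (vs ! i) = y $ i" if "i < ?n" for i
      using that bij by (simp add: x_def the_inv_into_f_f bij_betw_def)
    have sx: "(\<Sum>j\<in>{0..<?n}. if (v, vs ! j) \<in> parcs G then y $ j else 0) =
        (\<Sum>w\<in>V. if (v, w) \<in> parcs G then x w else 0)" for v
      unfolding sum[symmetric] by (intro sum.cong) (auto simp: x)
    show ?R
    proof (intro exI conjI ballI)
      show "\<exists>v\<in>V. x v \<noteq> 0"
      proof -
        obtain i where i: "i < ?n" "y $ i \<noteq> 0" using e ev[OF y] by blast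
        have "x (vs ! i) \<noteq> 0" using i x by simp
        then show ?thesis using nth_mem[OF i(1)] vs(2) by blast
      qed
      fix v assume "v \<in> V"
      then obtain i where i: "i < ?n" "v = vs ! i"
        unfolding vs(2)[symmetric] by (auto simp: in_set_conv_nth)
      have "(?Q *\<^sub>v y) $ i = k * y $ i" using e ev[OF y] i(1) by blast
      then show "?d v * x v + (\<Sum>w\<in>V. if (v, w) \<in> parcs G then x w else 0) = k * x v"
        unfolding row[OF y i(1)] x[OF i(1), symmetric] sx i(2) .
    qed
  next
    assume ?R
    then obtain x where nz: "\<exists>v\<in>V. x v \<noteq> 0" and
      eq: "\<And>v. v \<in> V \<Longrightarrow> ?d v * x v + (\<Sum>w\<in>V. if (v, w) \<in> parcs G then x w else 0) = k * x v"
      by blast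
    define y where "y = vec ?n (\<lambda>i. x (vs ! i))"
    have y: "y \<in> carrier_vec ?n" by (simp add: y_def)
    have yi: "y $ i = x (vs ! i)" if "i < ?n" for i using that by (simp add: y_def)
    have sy: "(\<Sum>j\<in>{0..<?n}. if (v, vs ! j) \<in> parcs G then y $ j else 0) =
        (\<Sum>w\<in>V. if (v, w) \<in> parcs G then x w else 0)" for v
      unfolding sum[symmetric] by (intro sum.cong) (auto simp: yi)
    obtain v where "v \<in> V" "x v \<noteq> 0" using nz by blast
    then obtain i where i: "i < ?n" "x (vs ! i) \<noteq> 0"
      unfolding vs(2)[symmetric] by (auto simp: in_set_conv_nth)
    have "\<exists>i<?n. y $ i \<noteq> 0" using i yi by auto
    moreover have "(?Q *\<^sub>v y) $ i = k * y $ i" if "i < ?n" for i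
      unfolding row[OF y that] yi[OF that] sy
      using eq[of "vs ! i"] nth_mem[OF that] vs(2) by blast
    ultimately show "eigenvalue ?Q k" using ev[OF y] by (auto simp: eigenvalue_def)
  qed
qed

lemma eigenvalue_signless_laplacian_enum:
  assumes "distinct vs" "distinct ws" "set vs = set ws"
  shows "eigenvalue (signless_laplacian G vs) k \<longleftrightarrow> eigenvalue (signless_laplacian G ws) k"
  unfolding eigenvalue_signless_laplacian_iff[OF assms(1,3)]
    eigenvalue_signless_laplacian_iff[OF assms(2) refl] ..

end

theory Submission
  imports Defs
begin

text \<open>
  If a positive vector \<open>x\<close> satisfies \<open>Q x < \<lambda> x\<close> entrywise, then \<open>q(G) < \<lambda>\<close>; here
  \<open>\<lambda> = q(S\<^bsub>n,2\<^esub>)\<close> exceeds \<open>n + 4 / 3\<close>.  In a graph without \<open>\<theta>(1,2,3)\<close> the neighbourhood of a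
  vertex \<open>u\<close> of degree \<open>d\<close> contains no path on four vertices, hence spans at most \<open>d\<close> edges, and
  common neighbours of \<open>u\<close> with a further vertex are restricted by the edges among them.
  If \<open>u\<close> is not adjacent to all other vertices, this gives
  \<open>d\<^sup>2 + \<Sum>\<^bsub>v \<sim> u\<^esub> d(v) \<le> (n + 4 / 3) d\<close>, so without a dominating vertex the vector of
  degrees is a suitable \<open>x\<close>.  With a dominating vertex \<open>u\<close>, the rest of the graph has no path on
  four vertices; either it is a spanning star and the graph is \<open>S\<^bsub>n,2\<^esub>\<close>, or the vector of degrees
  with a slightly larger entry at \<open>u\<close> works.
\<close>

section \<open>Real eigenvalues of the signless Laplacian\<close>

text \<open>Ensures that the maximum in \<open>signless_radius\<close> ranges over a nonempty set. A
  complex eigenvalue \<open>c\<close> exists, symmetry forces \<open>Im c = 0\<close>, and then the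
  real or the imaginary part of its eigenvector works.\<close>

lemma real_symmetric_mat_eigenvalue:
  fixes A :: "real mat"
  assumes A: "A \<in> carrier_mat n n" and n: "n > 0"
    and sym: "\<And>i j. i < n \<Longrightarrow> j < n \<Longrightarrow> A $$ (i, j) = A $$ (j, i)"
  shows "\<exists>k. eigenvalue A k"
proof -
  let ?C = "map_mat complex_of_real A"
  have C: "?C \<in> carrier_mat n n" using A by simp
  obtain c where "eigenvalue ?C c"
    using spectrum_non_empty[OF C n] by (auto simp: spectrum_def)
  then obtain y where y: "y \<in> carrier_vec n" "y \<noteq> 0\<^sub>v n" "?C *\<^sub>v y = c \<cdot>\<^sub>v y"
    using C by (auto simp: eigenvalue_def eigenvector_def)
  define a b where "a = map_vec Re y" and "b = map_vec Im y"
  have ab: "a \<in> carrier_vec n" "b \<in> carrier_vec n" using y(1) by (auto simp: a_def b_def)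
  have row: "(\<Sum>j<n. A $$ (i, j) * z $ j) = (A *\<^sub>v z) $ i" if "i < n" "z \<in> carrier_vec n" for i z
    using that A by (auto simp: scalar_prod_def lessThan_atLeast0)
  have eq: "(\<Sum>j<n. complex_of_real (A $$ (i, j)) * y $ j) = c * y $ i" if "i < n" for i
  proof -
    have "(?C *\<^sub>v y) $ i = (\<Sum>j<n. complex_of_real (A $$ (i, j)) * y $ j)"
      using that A y(1) by (auto simp: scalar_prod_def lessThan_atLeast0)
    then show ?thesis using y that by simp
  qed
  have re: "(\<Sum>j<n. A $$ (i, j) * a $ j) = Re c * a $ i - Im c * b $ i" if "i < n" for i
    using arg_cong[OF eq[OF that], of Re] that y(1) by (simp add: a_def b_def)
  have im: "(\<Sum>j<n. A $$ (i, j) * b $ j) = Re c * b $ i + Im c * a $ i" if "i < n" for i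
    using arg_cong[OF eq[OF that], of Im] that y(1) by (simp add: a_def b_def)
  \<comment> \<open>By symmetry, \<open>b\<close> paired with \<open>A a\<close> equals
    \<open>a\<close> paired with \<open>A b\<close>; inserting \<open>re\<close> and
    \<open>im\<close> leaves \<open>Im c\<close> times the squared norm of \<open>y\<close>.\<close>
  have "(\<Sum>i<n. b $ i * (\<Sum>j<n. A $$ (i, j) * a $ j)) = (\<Sum>i<n. \<Sum>j<n. A $$ (i, j) * (a $ j * b $ i))"
    by (simp add: sum_distrib_left mult_ac)
  also have "\<dots> = (\<Sum>j<n. \<Sum>i<n. A $$ (i, j) * (a $ j * b $ i))" by (rule sum.swap)
  also have "\<dots> = (\<Sum>j<n. \<Sum>i<n. A $$ (j, i) * (a $ j * b $ i))"
    by (intro sum.cong refl) (simp add: sym)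
  also have "\<dots> = (\<Sum>i<n. a $ i * (\<Sum>j<n. A $$ (i, j) * b $ j))"
    by (simp add: sum_distrib_left mult_ac)
  finally have "(\<Sum>i<n. b $ i * (Re c * a $ i - Im c * b $ i)) =
      (\<Sum>i<n. a $ i * (Re c * b $ i + Im c * a $ i))"
    by (simp add: re im)
  then have "(\<Sum>i<n. a $ i * (Re c * b $ i + Im c * a $ i) - b $ i * (Re c * a $ i - Im c * b $ i)) = 0"
    by (simp add: sum_subtractf)
  also have "(\<Sum>i<n. a $ i * (Re c * b $ i + Im c * a $ i) - b $ i * (Re c * a $ i - Im c * b $ i)) =
      Im c * (\<Sum>i<n. (a $ i)\<^sup>2 + (b $ i)\<^sup>2)"
    by (simp add: sum_distrib_left algebra_simps power2_eq_square)
  finally have s: "Im c * (\<Sum>i<n. (a $ i)\<^sup>2 + (b $ i)\<^sup>2) = 0" .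
  obtain i where i: "i < n" "y $ i \<noteq> 0" using y(1,2) by (auto simp: vec_eq_iff)
  then have nz: "a $ i \<noteq> 0 \<or> b $ i \<noteq> 0"
    using y(1) by (auto simp: a_def b_def complex_eq_iff)
  then have "(a $ i)\<^sup>2 + (b $ i)\<^sup>2 > 0" by (simp add: sum_power2_gt_zero_iff)
  then have "(\<Sum>i<n. (a $ i)\<^sup>2 + (b $ i)\<^sup>2) > 0"
    using i by (intro sum_pos2[of _ i]) auto
  then have "Im c = 0" using s by simp
  then have "(A *\<^sub>v a) $ i = Re c * a $ i" "(A *\<^sub>v b) $ i = Re c * b $ i" if "i < n" for i
    unfolding row[OF that ab(1), symmetric] row[OF that ab(2), symmetric]
    using re im that by simp_all
  then have "A *\<^sub>v a = Re c \<cdot>\<^sub>v a" "A *\<^sub>v b = Re c \<cdot>\<^sub>v b"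
    using ab A by (auto intro!: eq_vecI simp del: index_mult_mat_vec)
  moreover have "a \<noteq> 0\<^sub>v n \<or> b \<noteq> 0\<^sub>v n" using nz i by auto
  ultimately have "eigenvector A a (Re c) \<or> eigenvector A b (Re c)"
    using ab A by (auto simp: eigenvector_def)
  then show ?thesis by (auto simp: eigenvalue_def)
qed

text \<open>
  \<open>S_root n\<close> is the larger root of \<open>X\<^sup>2 - (n + 2) X + 4\<close>, the characteristic polynomial of the
  quotient of \<open>Q(S\<^bsub>n,2\<^esub>)\<close> by its two classes of vertices.
\<close>

definition S_root :: "nat \<Rightarrow> real" where
  "S_root n = (real n + 2 + sqrt ((real n + 2)\<^sup>2 - 16)) / 2"

lemma
  assumes "n \<ge> 6"
  shows S_root_eq: "S_root n * S_root n = (real n + 2) * S_root n - 4"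
    and S_root_gt: "S_root n > real n + 4 / 3"
proof -
  let ?t = "sqrt ((real n + 2)\<^sup>2 - 16)"
  have n: "real n \<ge> 6" using assms by simp
  then have "(real n + 2)\<^sup>2 \<ge> 8\<^sup>2" by (intro power_mono) auto
  then have "?t * ?t = (real n + 2)\<^sup>2 - 16" by simp
  then show "S_root n * S_root n = (real n + 2) * S_root n - 4"
    by (simp add: S_root_def field_simps power2_eq_square)
  \<comment> \<open>The bound \<open>n + 4 / 3\<close> on the root means \<open>n + 2 / 3\<close>
    for \<open>?t\<close>, as \<open>2 * (n + 4 / 3) - (n + 2) = n + 2 / 3\<close>.\<close>
  have "(real n + 2 / 3)\<^sup>2 < (real n + 2)\<^sup>2 - 16"
    using n by (simp add: power2_eq_square field_simps)
  then have "real n + 2 / 3 < ?t" by (rule real_less_rsqrt)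
  then show "S_root n > real n + 4 / 3" by (simp add: S_root_def field_simps)
qed

section \<open>Neighbourhoods and the eigenvalue equation\<close>

context pair_graph
begin

text \<open>\<open>v\<close> need not lie in \<open>A\<close>: for \<open>w\<close> outside
  \<open>N u\<close>, \<open>nb (N u) w\<close> consists of the common neighbours of
  \<open>u\<close> and \<open>w\<close>.\<close>

definition nb :: "'a set \<Rightarrow> 'a \<Rightarrow> 'a set" where
  "nb A v = {w \<in> A. (v, w) \<in> parcs G}"

abbreviation deg_in :: "'a set \<Rightarrow> 'a \<Rightarrow> nat" where
  "deg_in A v \<equiv> card (nb A v)"

abbreviation N :: "'a \<Rightarrow> 'a set" where "N \<equiv> nb (pverts G)"
abbreviation d :: "'a \<Rightarrow> nat" where "d \<equiv> deg_in (pverts G)"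

lemma adj_sym: "(v, w) \<in> parcs G \<longleftrightarrow> (w, v) \<in> parcs G"
  using arcs_symmetric by blast

lemma adj_irrefl [simp]: "(v, v) \<notin> parcs G"
  using no_loops'[of v v] by blast

lemma adj_neq: "(v, w) \<in> parcs G \<Longrightarrow> v \<noteq> w"
  by auto

lemma adj_verts: "(v, w) \<in> parcs G \<Longrightarrow> v \<in> pverts G \<and> w \<in> pverts G"
  using wellformed' by blast

lemma finite_nb [simp]: "finite (nb (pverts G) v)"
  using pair_finite_verts by (simp add: nb_def)

lemma mem_N [simp]: "w \<in> N v \<longleftrightarrow> (v, w) \<in> parcs G"
  using adj_verts by (auto simp: nb_def)

lemma out_degree_eq_d: "out_degree (with_proj G) v = d v"
proof -
  have "out_arcs (with_proj G) v = Pair v ` N v" by (auto simp: out_arcs_def)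
  then show ?thesis by (simp add: out_degree_def card_image inj_on_def)
qed

lemma eigenvalue_iff:
  "eigenvalue (signless_laplacian G (vertex_enum G)) k \<longleftrightarrow>
    (\<exists>x. (\<exists>v\<in>pverts G. x v \<noteq> 0) \<and> (\<forall>v\<in>pverts G. (\<Sum>w\<in>N v. x v + x w) = k * x v))"
proof -
  have *: "(\<Sum>w\<in>pverts G. if (v, w) \<in> parcs G then x w else 0) = (\<Sum>w\<in>N v. x w)"
    for v and x :: "'a \<Rightarrow> real"
    using pair_finite_verts by (simp add: nb_def sum.inter_filter)
  show ?thesis
    unfolding eigenvalue_signless_laplacian_iff[OF vertex_enum[OF pair_finite_verts]]
    by (simp add: * out_degree_eq_d sum.distrib)
qed

section \<open>Bounds on the radius from positive vectors\<close>

lemma signless_radius_mem: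
  assumes "pverts G \<noteq> {}"
  shows "eigenvalue (signless_laplacian G (vertex_enum G)) (signless_radius G)"
proof -
  let ?vs = "vertex_enum G"
  have "length ?vs > 0" using assms vertex_enum(2)[OF pair_finite_verts] by auto
  moreover have "signless_laplacian G ?vs $$ (i, j) = signless_laplacian G ?vs $$ (j, i)"
    if "i < length ?vs" "j < length ?vs" for i j
    using that adj_sym by (auto simp: signless_laplacian_def degree_mat_def adjacency_mat_def)
  ultimately have "\<exists>k. eigenvalue (signless_laplacian G ?vs) k"
    using real_symmetric_mat_eigenvalue[OF signless_laplacian_carrier] by blast
  then have "Max {k. eigenvalue (signless_laplacian G ?vs) k}
      \<in> {k. eigenvalue (signless_laplacian G ?vs) k}"
    by (intro Max_in[OF finite_eigenvalues_signless_laplacian]) blast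
  then show ?thesis by (simp add: signless_radius_def)
qed

lemma signless_radius_ge:
  "eigenvalue (signless_laplacian G (vertex_enum G)) k \<Longrightarrow> k \<le> signless_radius G"
  unfolding signless_radius_def
  by (rule Max_ge[OF finite_eigenvalues_signless_laplacian]) simp

text \<open>The eigenvector is compared with \<open>x\<close> at a vertex where the ratio \<open>\<bar>z v\<bar> / x v\<close> is largest.\<close>

lemma signless_radius_test_vector:
  assumes "pverts G \<noteq> {}" and pos: "\<And>v. v \<in> pverts G \<Longrightarrow> x v > 0"
  obtains v where "v \<in> pverts G" "signless_radius G * x v \<le> (\<Sum>w\<in>N v. x v + x w)"
proof -
  let ?q = "signless_radius G"
  obtain z where nz: "\<exists>v\<in>pverts G. z v \<noteq> 0"
    and z: "\<And>v. v \<in> pverts G \<Longrightarrow> (\<Sum>w\<in>N v. z v + z w) = ?q * z v"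
    using signless_radius_mem[OF assms(1)] unfolding eigenvalue_iff by blast
  define r where "r v = \<bar>z v\<bar> / x v" for v
  define m where "m = Max (r ` pverts G)"
  have fin: "finite (r ` pverts G)" using pair_finite_verts by simp
  have "m \<in> r ` pverts G" unfolding m_def using assms(1) fin by (intro Max_in) auto
  then obtain v where v: "v \<in> pverts G" "r v = m" by auto
  have le: "\<bar>z w\<bar> \<le> m * x w" if "w \<in> pverts G" for w
  proof -
    have "r w \<le> m" unfolding m_def using that fin by simp
    then show ?thesis using pos[OF that] by (simp add: r_def divide_simps)
  qed
  obtain u where u: "u \<in> pverts G" "z u \<noteq> 0" using nz by blast
  then have "0 < m * x u" using le[of u] by linarith
  then have m: "m > 0" using pos[OF u(1)] by (simp add: zero_less_mult_iff)
  have zv: "\<bar>z v\<bar> = m * x v" using v pos[OF v(1)] by (auto simp: r_def)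
  have "?q * (m * x v) \<le> \<bar>?q * z v\<bar>" by (simp add: abs_mult zv[symmetric] mult_right_mono)
  also have "\<dots> = \<bar>\<Sum>w\<in>N v. z v + z w\<bar>" using z[OF v(1)] by simp
  also have "\<dots> \<le> (\<Sum>w\<in>N v. \<bar>z v + z w\<bar>)" by (rule sum_abs)
  also have "\<dots> \<le> (\<Sum>w\<in>N v. m * (x v + x w))"
  proof (rule sum_mono)
    fix w assume "w \<in> N v"
    then have "w \<in> pverts G" using adj_verts by auto
    then show "\<bar>z v + z w\<bar> \<le> m * (x v + x w)"
      using le[of w] zv abs_triangle_ineq[of "z v" "z w"] by (simp add: algebra_simps)
  qed
  also have "\<dots> = m * (\<Sum>w\<in>N v. x v + x w)" by (rule sum_distrib_left[symmetric])
  finally have "m * (?q * x v) \<le> m * (\<Sum>w\<in>N v. x v + x w)" by (simp add: mult_ac)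
  then have "?q * x v \<le> (\<Sum>w\<in>N v. x v + x w)" using m by simp
  then show ?thesis using that v(1) by blast
qed

lemma signless_radius_less:
  assumes "pverts G \<noteq> {}" and "\<And>v. v \<in> pverts G \<Longrightarrow> x v > 0"
    and "\<And>v. v \<in> pverts G \<Longrightarrow> (\<Sum>w\<in>N v. x v + x w) < k * x v"
  shows "signless_radius G < k"
proof -
  obtain v where v: "v \<in> pverts G" "signless_radius G * x v \<le> (\<Sum>w\<in>N v. x v + x w)"
    using signless_radius_test_vector[of x] assms(1,2) by blast
  then have "signless_radius G * x v < k * x v" using assms(3)[of v] by linarith
  then show ?thesis using assms(2)[OF v(1)] by simp
qed

text \<open>A positive eigenvector belongs to the largest eigenvalue: as a test vector it bounds the
  radius by \<open>k\<close>, and \<open>k\<close> is itself an eigenvalue.\<close>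

lemma signless_radius_eqI:
  assumes "pverts G \<noteq> {}" and "\<And>v. v \<in> pverts G \<Longrightarrow> x v > 0"
    and eq: "\<And>v. v \<in> pverts G \<Longrightarrow> (\<Sum>w\<in>N v. x v + x w) = k * x v"
  shows "signless_radius G = k"
proof (rule antisym)
  obtain v where v: "v \<in> pverts G" "signless_radius G * x v \<le> (\<Sum>w\<in>N v. x v + x w)"
    using signless_radius_test_vector[of x] assms(1,2) by blast
  then have "signless_radius G * x v \<le> k * x v" using eq[of v] by linarith
  then show "signless_radius G \<le> k" using assms(2)[OF v(1)] by simp
  have "\<exists>v\<in>pverts G. x v \<noteq> 0" using assms(1,2) by force
  then have "eigenvalue (signless_laplacian G (vertex_enum G)) k"
    unfolding eigenvalue_iff using eq by blast
  then show "k \<le> signless_radius G" by (rule signless_radius_ge)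
qed


section \<open>Sets of vertices without a path on four vertices\<close>

text \<open>The path need not be induced, so the components of the graph on such an \<open>A\<close>
  are triangles and stars, single vertices included.\<close>

definition P4_free :: "'a set \<Rightarrow> bool" where
  "P4_free A \<longleftrightarrow> \<not> (\<exists>a\<in>A. \<exists>b\<in>A. \<exists>c\<in>A. \<exists>e\<in>A. distinct [a, b, c, e] \<and>
     (a, b) \<in> parcs G \<and> (b, c) \<in> parcs G \<and> (c, e) \<in> parcs G)"

lemma P4_free_subset: "P4_free A \<Longrightarrow> B \<subseteq> A \<Longrightarrow> P4_free B"
  unfolding P4_free_def by blast

text \<open>A second neighbour \<open>b\<close> of \<open>w\<close> would give a path
  \<open>c, v, w, b\<close>: degree 3 provides a neighbour \<open>c\<close> of \<open>v\<close>
  other than \<open>w\<close> and \<open>b\<close>.\<close>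

lemma P4_free_leaf:
  assumes "P4_free A" "finite A" "v \<in> A" "w \<in> A" "(v, w) \<in> parcs G" "deg_in A v \<ge> 3"
  shows "deg_in A w = 1"
proof -
  have "nb A w = {v}"
  proof (rule ccontr)
    assume "nb A w \<noteq> {v}"
    moreover have "v \<in> nb A w" using assms adj_sym by (auto simp: nb_def)
    ultimately obtain b where b: "b \<in> A" "(w, b) \<in> parcs G" "b \<noteq> v" by (auto simp: nb_def)
    have "\<not> nb A v \<subseteq> {w, b}"
      using card_mono[of "{w, b}" "nb A v"] assms(6) card_insert_le_m1[of 2 "{b}" w] by auto
    then obtain c where c: "c \<in> A" "(v, c) \<in> parcs G" "c \<noteq> w" "c \<noteq> b" by (auto simp: nb_def)
    have "distinct [c, v, w, b]" using b c assms(5) by auto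
    then show False using assms(1,3,4,5) b c adj_sym unfolding P4_free_def by blast
  qed
  then show ?thesis by simp
qed

lemma P4_free_edge_cases:
  assumes "P4_free A" "finite A" "v \<in> A" "w \<in> A" "(v, w) \<in> parcs G"
  shows "deg_in A v = 1 \<or> deg_in A w = 1 \<or> (deg_in A v = 2 \<and> deg_in A w = 2)"
proof -
  have "v \<in> nb A w" "w \<in> nb A v" "finite (nb A v)" "finite (nb A w)"
    using assms adj_sym by (auto simp: nb_def)
  then have "deg_in A v > 0" "deg_in A w > 0" by (auto simp: card_gt_0_iff)
  moreover have "deg_in A w = 1" if "deg_in A v \<ge> 3" using P4_free_leaf[OF assms that] .
  moreover have "deg_in A v = 1" if "deg_in A w \<ge> 3"
    using P4_free_leaf[OF assms(1,2,4,3) _ that] assms(5) adj_sym by blast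
  ultimately show ?thesis by linarith
qed

text \<open>
  Each edge \<open>vw\<close> sends the charges \<open>1 / deg v\<close> and \<open>1 / deg w\<close> to its endpoints; by the previous
  lemma these add up to at least \<open>1\<close>, and each non-isolated vertex receives exactly \<open>1\<close>.
\<close>

lemma P4_free_sum_deg:
  assumes "P4_free A" "finite A"
  shows "(\<Sum>v\<in>A. deg_in A v) \<le> 2 * card {v \<in> A. nb A v \<noteq> {}}"
proof -
  have fin: "finite (nb A v)" for v using assms(2) by (simp add: nb_def)
  let ?g = "\<lambda>v. 1 / real (deg_in A v)"
  have "real (\<Sum>v\<in>A. deg_in A v) = (\<Sum>v\<in>A. \<Sum>w\<in>nb A v. 1)" by simp
  also have "\<dots> \<le> (\<Sum>v\<in>A. \<Sum>w\<in>nb A v. ?g v + ?g w)"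
  proof (intro sum_mono)
    fix v w assume "v \<in> A" "w \<in> nb A v"
    then have "deg_in A v = 1 \<or> deg_in A w = 1 \<or> (deg_in A v = 2 \<and> deg_in A w = 2)"
      using P4_free_edge_cases[OF assms, of v w] by (auto simp: nb_def)
    then show "1 \<le> ?g v + ?g w" by auto
  qed
  also have "\<dots> = (\<Sum>v\<in>A. \<Sum>w\<in>nb A v. ?g v) + (\<Sum>v\<in>A. \<Sum>w\<in>nb A v. ?g w)"
    by (simp add: sum.distrib)
  also have "(\<Sum>v\<in>A. \<Sum>w\<in>nb A v. ?g w) = (\<Sum>w\<in>A. \<Sum>v\<in>nb A w. ?g w)"
    unfolding nb_def using sum.swap_restrict[OF assms(2) assms(2), of "\<lambda>v w. ?g w" "\<lambda>v w. (v, w) \<in> parcs G"]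
    by (simp add: adj_sym nb_def)
  also have "(\<Sum>w\<in>A. \<Sum>v\<in>nb A w. ?g w) = (\<Sum>w\<in>A. if nb A w \<noteq> {} then 1 else 0)"
    using fin by (intro sum.cong) auto
  also have "\<dots> = real (card {v \<in> A. nb A v \<noteq> {}})"
    using assms(2) by (simp add: sum.inter_filter[symmetric])
  finally show ?thesis by linarith
qed

text \<open>An isolated edge adds 2 to the degree sum, where the general bound allows 4; deleting it
  leaves the other degrees unchanged.\<close>

lemma P4_free_sum_deg_isolated_edge:
  assumes "P4_free A" "finite A" "nb A a = {b}" "nb A b = {a}"
  shows "(\<Sum>v\<in>A. deg_in A v) \<le> 2 * card A - 2"
proof -
  have ab: "a \<in> A" "b \<in> A" "a \<noteq> b" using assms(3,4) by (auto simp: nb_def)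
  let ?B = "A - {a, b}"
  have nb: "nb ?B v = nb A v" if "v \<in> ?B" for v
  proof -
    have "a \<notin> nb A v" "b \<notin> nb A v"
      using that assms(3,4) adj_sym by (auto simp: nb_def)
    then show ?thesis by (auto simp: nb_def)
  qed
  have "(\<Sum>v\<in>A. deg_in A v) = (\<Sum>v\<in>?B. deg_in A v) + (\<Sum>v\<in>{a, b}. deg_in A v)"
    using ab assms(2) by (intro sum.subset_diff) auto
  also have "(\<Sum>v\<in>?B. deg_in A v) = (\<Sum>v\<in>?B. deg_in ?B v)" using nb by simp
  also have "\<dots> \<le> 2 * card {v \<in> ?B. nb ?B v \<noteq> {}}"
    using assms by (intro P4_free_sum_deg) (auto intro: P4_free_subset)
  also have "\<dots> \<le> 2 * card ?B" using assms(2) by (intro mult_le_mono card_mono) auto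
  also have "card ?B = card A - 2" using ab assms(2) by (simp add: card_Diff_subset)
  also have "(\<Sum>v\<in>{a, b}. deg_in A v) = 2" using ab assms(3,4) by simp
  finally have *: "(\<Sum>v\<in>A. deg_in A v) \<le> 2 * (card A - 2) + 2" by simp
  have "card {a, b} \<le> card A" using ab assms(2) by (intro card_mono) auto
  then show ?thesis using * ab(3) by simp
qed


section \<open>Graphs without a house\<close>

text \<open>The house, a 5-cycle with a chord, is \<open>\<theta>(1,2,3)\<close>; its chord is \<open>st\<close>.\<close>

definition house_free :: bool where
  "house_free \<longleftrightarrow> \<not> (\<exists>s t a b c. distinct [s, t, a, b, c] \<and>
     (s, t) \<in> parcs G \<and> (s, a) \<in> parcs G \<and> (a, t) \<in> parcs G \<and>
     (s, b) \<in> parcs G \<and> (b, c) \<in> parcs G \<and> (c, t) \<in> parcs G)"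

lemma no_house:
  assumes house_free "distinct [s, t, a, b, c]" "(s, t) \<in> parcs G" "(s, a) \<in> parcs G"
    "(a, t) \<in> parcs G" "(s, b) \<in> parcs G" "(b, c) \<in> parcs G" "(c, t) \<in> parcs G"
  shows False
  using assms unfolding house_free_def by blast

text \<open>A path \<open>p, q, r, t\<close> in \<open>N u\<close> closes through \<open>u\<close>
  to a 5-cycle with chord \<open>uq\<close>.\<close>

lemma P4_free_N:
  assumes house_free
  shows "P4_free (N u)"
proof -
  have False if "(u, p) \<in> parcs G" "(u, q) \<in> parcs G" "(u, r) \<in> parcs G" "(u, t) \<in> parcs G"
    "distinct [p, q, r, t]" "(p, q) \<in> parcs G" "(q, r) \<in> parcs G" "(r, t) \<in> parcs G" for p q r t
    using no_house[OF assms, of u q p t r] that that(1-4)[THEN adj_neq] adj_sym by auto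
  then show ?thesis unfolding P4_free_def mem_N Ball_def Bex_def by blast
qed

text \<open>
  The neighbours of \<open>w\<close> in \<open>N u\<close> are either all isolated in \<open>N u\<close>, or the two ends of an isolated
  edge of \<open>N u\<close>, or there is at most one of them.
\<close>

lemma house_free_count:
  assumes hf: house_free and w: "w \<noteq> u" "(u, w) \<notin> parcs G"
  shows "3 * ((\<Sum>v\<in>N u. deg_in (N u) v) + deg_in (N u) w) \<le> 7 * d u"
proof -
  let ?A = "N u" and ?K = "nb (N u) w"
  define s where "s = (\<Sum>v\<in>?A. deg_in ?A v)"
  let ?J = "{v \<in> ?A. nb ?A v \<noteq> {}}"
  note P4 = P4_free_N[OF hf, of u]
  have fin: "finite ?A" by simp
  have K: "?K \<subseteq> ?A" by (auto simp: nb_def)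
  have kd: "card ?K \<le> d u" using card_mono[OF fin K] .
  have J: "s \<le> 2 * card ?J" unfolding s_def by (rule P4_free_sum_deg[OF P4 fin])
  have finJ: "finite ?J" by (rule finite_subset[OF _ fin]) blast
  have Jd: "card ?J \<le> d u" by (rule card_mono[OF fin]) blast
  \<comment> \<open>Another common neighbour \<open>b\<close> would complete the 5-cycle
    \<open>u, a, t, w, b\<close> with chord \<open>ut\<close>.\<close>
  have pair: "?K \<subseteq> {t, a}" if "t \<in> ?K" "a \<in> nb ?A t" for t a
  proof
    fix b assume b: "b \<in> ?K"
    show "b \<in> {t, a}"
    proof (rule ccontr)
      assume "b \<notin> {t, a}"
      moreover have "a \<noteq> w" "b \<noteq> w" "t \<noteq> w" "u \<noteq> t" "u \<noteq> a" "u \<noteq> b" "a \<noteq> t"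
        using that b w by (auto simp: nb_def)
      ultimately have "distinct [u, t, a, b, w]" using w(1) by auto
      then show False using no_house[OF hf, of u t a b w] that b adj_sym by (auto simp: nb_def)
    qed
  qed
  \<comment> \<open>The factor \<open>7 / 3\<close> comes from the third case, where
    \<open>s \<le> 2 * d u\<close> and one common neighbour give \<open>2 * d u + 1\<close>, with
    \<open>d u \<ge> 3\<close>. In the other cases the sum is at most
    \<open>2 * d u\<close>.\<close>
  consider "d u \<le> 2" | "d u \<ge> 3" "?K \<inter> ?J = {}" | "d u \<ge> 3" "card ?K \<le> 1"
    | "?K \<inter> ?J \<noteq> {}" "card ?K \<ge> 2" by linarith
  then have "3 * s + 3 * card ?K \<le> 7 * d u"
  proof cases
    case 1
    have "deg_in ?A v \<le> 1" if "v \<in> ?A" for v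
    proof -
      have "nb ?A v \<subseteq> ?A - {v}" by (auto simp: nb_def)
      then have "deg_in ?A v \<le> card (?A - {v})" by (intro card_mono) auto
      also have "\<dots> \<le> 1" using that 1 by (subst card_Diff_singleton) auto
      finally show ?thesis .
    qed
    then have "s \<le> (\<Sum>v\<in>?A. 1)" unfolding s_def by (rule sum_mono)
    then show ?thesis using kd by simp
  next
    case 2
    then have "card ?K \<le> card (?A - ?J)" using K by (intro card_mono) auto
    also have "\<dots> = d u - card ?J" by (rule card_Diff_subset[OF finJ]) blast
    finally have "card ?K + card ?J \<le> d u" by (rule le_diff_conv2[OF Jd, THEN iffD1])
    then show ?thesis using J by linarith
  next
    case 3
    then show ?thesis using J Jd by linarith
  next
    case 4
    then obtain t a where t: "t \<in> ?K" and a: "a \<in> nb ?A t" by blast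
    have ta: "t \<noteq> a" using a by (auto simp: nb_def)
    have sub: "?K \<subseteq> {t, a}" using pair[OF t a] .
    have K2: "?K = {t, a}"
    proof (rule card_seteq[OF _ sub])
      show "card {t, a} \<le> card ?K" using 4(2) by (simp add: ta)
    qed simp
    then have t': "t \<in> nb ?A a" and a': "a \<in> ?K" using a K adj_sym by (auto simp: nb_def)
    have "nb ?A t = {a}"
    proof
      show "nb ?A t \<subseteq> {a}" using pair[OF t] K2 ta by blast
    qed (use a in simp)
    moreover have "nb ?A a = {t}"
    proof
      show "nb ?A a \<subseteq> {t}" using pair[OF a'] K2 ta by blast
    qed (use t' in simp)
    ultimately have "s \<le> 2 * d u - 2" unfolding s_def by (intro P4_free_sum_deg_isolated_edge[OF P4 fin])
    moreover have "card ?K = 2" using K2 ta by simp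
    ultimately show ?thesis using kd by linarith
  qed
  then show ?thesis unfolding s_def distrib_left .
qed

text \<open>A neighbour \<open>v\<close> of \<open>u\<close> sees \<open>u\<close>, part of
  \<open>N u\<close>, possibly a fixed non-neighbour \<open>w\<close> of \<open>u\<close>, and some
  of the \<open>?n - d u - 2\<close> other vertices. Keeping \<open>w\<close> apart lets
  \<open>house_free_count\<close> bound the surplus over
  \<open>d u * (?n - 1 - d u)\<close>.\<close>

lemma house_free_sum_d:
  assumes hf: house_free and u: "u \<in> pverts G" and nd: "d u + 2 \<le> card (pverts G)"
  shows "3 * (d u * d u + (\<Sum>v\<in>N u. d v)) \<le> (3 * card (pverts G) + 4) * d u"
proof -
  let ?n = "card (pverts G)"
  have "card (insert u (N u)) < ?n" using nd by simp
  then have "\<not> pverts G \<subseteq> insert u (N u)" using card_mono[of "insert u (N u)" "pverts G"] by auto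
  then have "\<exists>w\<in>pverts G. w \<notin> insert u (N u)" by blast
  then obtain w where w: "w \<in> pverts G" "w \<noteq> u" "(u, w) \<notin> parcs G" by auto
  let ?r = "pverts G - insert u (insert w (N u))"
  have "insert u (insert w (N u)) \<subseteq> pverts G" using u w adj_verts by auto
  then have r: "card ?r = ?n - (d u + 2)"
    using w by (subst card_Diff_subset) auto
  then have r': "card ?r + 1 = ?n - 1 - d u" using nd by linarith
  have dv: "d v \<le> (?n - 1 - d u) + deg_in (N u) v + (if (w, v) \<in> parcs G then 1 else 0)"
    if "v \<in> N u" for v
  proof -
    let ?w = "if (w, v) \<in> parcs G then {w} else {}"
    have "N v \<subseteq> {u} \<union> (nb (N u) v \<union> (?w \<union> ?r))"
      using adj_verts adj_sym by (auto simp: nb_def)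
    then have "d v \<le> card ({u} \<union> (nb (N u) v \<union> (?w \<union> ?r)))"
      using pair_finite_verts by (intro card_mono) (auto simp: nb_def)
    also have "\<dots> \<le> card {u} + (card (nb (N u) v) + (card ?w + card ?r))"
      by (intro order_trans[OF card_Un_le] add_left_mono order_refl)
    also have "\<dots> = (?n - 1 - d u) + deg_in (N u) v + (if (w, v) \<in> parcs G then 1 else 0)"
      unfolding r'[symmetric] by simp
    finally show ?thesis .
  qed
  have "(\<Sum>v\<in>N u. d v) \<le>
      (\<Sum>v\<in>N u. (?n - 1 - d u) + deg_in (N u) v + (if (w, v) \<in> parcs G then 1 else 0))"
    by (rule sum_mono[OF dv])
  also have "\<dots> = d u * (?n - 1 - d u) + ((\<Sum>v\<in>N u. deg_in (N u) v) + deg_in (N u) w)"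
    by (simp add: sum.distrib sum.inter_filter[symmetric] nb_def)
  finally have le: "(\<Sum>v\<in>N u. d v) \<le> \<dots>" .
  have "3 * S \<le> 3 * k + 7 * e" if "S \<le> k + m" "3 * m \<le> 7 * e" for S k m e :: nat
    using that by linarith
  from this[OF le house_free_count[OF hf w(2,3)]]
  have "3 * (\<Sum>v\<in>N u. d v) \<le> 3 * (d u * (?n - 1 - d u)) + 7 * d u" .
  moreover have "d u * d u + d u * (?n - 1 - d u) + d u = ?n * d u"
  proof -
    obtain m where "?n = d u + 1 + m" using nd by (metis add.assoc le_Suc_ex add_Suc_right Suc_1 nat_1_add_1)
    then show ?thesis by (simp add: algebra_simps)
  qed
  ultimately show ?thesis by (simp add: algebra_simps)
qed

section \<open>Graphs with a dominating vertex\<close>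

text \<open>Describes the extremal graph on the vertices of \<open>G\<close> itself, with
  \<open>u\<close> and \<open>v\<close> in the roles of 0 and 1 of \<open>S_graph\<close>;
  isomorphisms enter only at the end.\<close>

definition S2_at :: "'a \<Rightarrow> 'a \<Rightarrow> bool" where
  "S2_at u v \<longleftrightarrow> u \<in> pverts G \<and> v \<in> pverts G \<and> u \<noteq> v \<and>
     parcs G = {(a, b). a \<in> pverts G \<and> b \<in> pverts G \<and> a \<noteq> b \<and> (a \<in> {u, v} \<or> b \<in> {u, v})}"

lemma signless_radius_S2:
  assumes "S2_at u v" and n: "card (pverts G) = n" "n \<ge> 6"
  shows "signless_radius G = S_root n"
proof (rule signless_radius_eqI)
  let ?l = "S_root n"
  \<comment> \<open>Constant on the two classes: a vertex of degree 2 gives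
    \<open>4 + 2 * (?l - 2) = 2 * ?l\<close>, and \<open>u\<close> and \<open>v\<close> give the
    quadratic equation of \<open>?l\<close>.\<close>
  define x where "x w = (if w = u \<or> w = v then ?l - 2 else 2)" for w
  have uv: "u \<in> pverts G" "v \<in> pverts G" "u \<noteq> v"
    and E: "\<And>a b. (a, b) \<in> parcs G \<longleftrightarrow>
      a \<in> pverts G \<and> b \<in> pverts G \<and> a \<noteq> b \<and> (a \<in> {u, v} \<or> b \<in> {u, v})"
    using assms(1) by (simp_all add: S2_at_def)
  show "pverts G \<noteq> {}" using uv by blast
  have l: "?l > 2" using S_root_gt[OF n(2)] n(2) by simp
  then show "x w > 0" for w by (simp add: x_def)
  have dom: "(\<Sum>w\<in>N p. x p + x w) = ?l * x p" if p: "p = u \<and> q = v \<or> p = v \<and> q = u" for p q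
  proof -
    let ?R = "pverts G - {u, v}"
    have R: "card ?R = n - 2" using uv n(1) by (simp add: card_Diff_subset)
    have "N p = insert q ?R" using E p uv by auto
    moreover have "finite ?R" "q \<notin> ?R" using p pair_finite_verts by auto
    ultimately have "(\<Sum>w\<in>N p. x p + x w) = (x p + x q) + (\<Sum>w\<in>?R. x p + x w)"
      by (simp only: sum.insert not_False_eq_True)
    also have "(\<Sum>w\<in>?R. x p + x w) = (\<Sum>w\<in>?R. ?l)"
      using p by (intro sum.cong) (auto simp: x_def)
    also have "x p + x q + (\<Sum>w\<in>?R. ?l) = 2 * (?l - 2) + (real n - 2) * ?l"
      using p R n(2) by (auto simp: x_def of_nat_diff)
    also have "\<dots> = ?l * x p"
      using S_root_eq[OF n(2)] p by (auto simp: x_def algebra_simps)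
    finally show ?thesis .
  qed
  fix w assume w: "w \<in> pverts G"
  show "(\<Sum>y\<in>N w. x w + x y) = ?l * x w"
  proof (cases "w = u \<or> w = v")
    case True
    then show ?thesis using dom[of w "if w = u then v else u"] uv by auto
  next
    case False
    then have "N w = {u, v}" using E uv w by auto
    then show ?thesis using uv(3) False by (simp add: x_def)
  qed
qed

text \<open>
  The vector of degrees itself fails at \<open>u\<close> when the rest of the graph has many edges; the
  increment \<open>4 / 3\<close> of its entry there is absorbed by \<open>S_root n > n + 4 / 3\<close> at the vertices
  of degree \<open>1\<close>.
\<close>

lemma signless_radius_dominating:
  assumes hf: house_free and u: "u \<in> pverts G" "N u = pverts G - {u}"
    and n: "card (pverts G) = n" "n \<ge> 6" and noS: "\<And>v. \<not> S2_at u v"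
  shows "signless_radius G < S_root n"
proof -
  let ?l = "S_root n" and ?A = "N u"
  let ?h = "deg_in ?A"
  note P4 = P4_free_N[OF hf, of u]
  have fin: "finite ?A" by simp
  have cA: "card ?A = n - 1" using u n by simp
  have Nv: "N v = insert u (nb ?A v)" if "v \<in> ?A" for v
    using that u adj_sym adj_verts by (auto simp: nb_def)
  have unb: "u \<notin> nb ?A v" for v by (simp add: nb_def)
  have finb: "finite (nb ?A v)" for v using fin by (simp add: nb_def)
  have leaf: "?h w = 1" if "w \<in> nb ?A v" "?h v \<ge> 3" "v \<in> ?A" for v w
    using P4_free_leaf[OF P4 fin that(3) _ _ that(2)] that(1) by (auto simp: nb_def)
  \<comment> \<open>\<open>?A\<close> has \<open>n - 1\<close> vertices, so with
    \<open>n - 2\<close> neighbours there \<open>v\<close> would see all the others; by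
    \<open>leaf\<close> they form a star at \<open>v\<close>, contrary to
    \<open>noS\<close>.\<close>
  have h: "?h v \<le> n - 3" if v: "v \<in> ?A" for v
  proof (rule ccontr)
    assume "\<not> ?h v \<le> n - 3"
    then have *: "?h v \<ge> n - 2" by simp
    have "nb ?A v = ?A - {v}"
    proof (rule card_seteq)
      show "card (?A - {v}) \<le> ?h v" using * v cA by simp
    qed (auto simp: nb_def)
    note nbv = this
    have other: "nb ?A w = {v}" if w: "w \<in> ?A" "w \<noteq> v" for w
    proof -
      have "w \<in> nb ?A v" using nbv w by simp
      moreover have "?h v \<ge> 3" using * n(2) by linarith
      ultimately have "?h w = 1" by (rule leaf[OF _ _ v])
      moreover have "v \<in> nb ?A w" using \<open>w \<in> nb ?A v\<close> v adj_sym by (auto simp: nb_def)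
      ultimately show ?thesis by (auto simp: card_1_singleton_iff)
    qed
    have "(a, b) \<in> parcs G \<longleftrightarrow>
        a \<in> pverts G \<and> b \<in> pverts G \<and> a \<noteq> b \<and> (a \<in> {u, v} \<or> b \<in> {u, v})" for a b
    proof -
      consider "a = u" | "a = v" | "a \<in> ?A" "a \<noteq> v" | "a \<notin> pverts G" using u(2) by blast
      then show ?thesis
      proof cases
        case 1
        then show ?thesis using u by (auto simp: mem_N[symmetric] simp del: mem_N)
      next
        case 2
        then have "N a = pverts G - {v}" using Nv[OF v] nbv u v by auto
        then show ?thesis using 2 v u(2) by (auto simp: mem_N[symmetric] simp del: mem_N)
      next
        case 3
        then have "N a = {u, v}" using Nv[of a] other[of a] by auto
        then show ?thesis using 3 v u by (auto simp: mem_N[symmetric] simp del: mem_N)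
      next
        case 4
        then show ?thesis using adj_verts by blast
      qed
    qed
    then have "S2_at u v" unfolding S2_at_def using u v by auto
    then show False using noS by blast
  qed
  \<comment> \<open>The entry \<open>n + 1 / 3\<close> at \<open>u\<close> is the solution
    \<open>y\<close> of \<open>(n - 1) * (y + 3) = (n + 2) * y - 4\<close>, and together with an
    entry 1 it gives \<open>n + 4 / 3\<close>.\<close>
  define x where "x w = (if w = u then real n + 1 / 3 else real (?h w) + 1)" for w
  have n6: "real n \<ge> 6" using n(2) by simp
  have l: "?l > real n + 4 / 3" by (rule S_root_gt[OF n(2)])
  show ?thesis
  proof (rule signless_radius_less)
    show "pverts G \<noteq> {}" using u by blast
    show "x v > 0" for v using n6 by (simp add: x_def)
    fix v assume v: "v \<in> pverts G"
    show "(\<Sum>w\<in>N v. x v + x w) < ?l * x v"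
    proof (cases "v = u")
      case True
      have "(\<Sum>w\<in>?A. ?h w) \<le> 2 * card {w \<in> ?A. nb ?A w \<noteq> {}}"
        by (rule P4_free_sum_deg[OF P4 fin])
      also have "\<dots> \<le> 2 * card ?A" by (intro mult_le_mono2 card_mono) auto
      finally have "real (\<Sum>w\<in>?A. ?h w) \<le> real (2 * (n - 1))"
        unfolding cA by (rule of_nat_mono)
      also have "\<dots> = 2 * (real n - 1)" using n(2) by (simp add: of_nat_diff)
      finally have "real (\<Sum>w\<in>?A. ?h w) \<le> 2 * (real n - 1)" .
      moreover have "(\<Sum>w\<in>?A. x u + x w) = (\<Sum>w\<in>?A. (x u + 1) + real (?h w))"
        by (intro sum.cong) (auto simp: x_def)
      moreover have "\<dots> = (real n - 1) * (x u + 1) + real (\<Sum>w\<in>?A. ?h w)"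
        using cA n(2) by (simp add: sum.distrib of_nat_diff)
      ultimately have "(\<Sum>w\<in>?A. x u + x w) \<le> (real n - 1) * (x u + 3)"
        by (simp add: algebra_simps)
      \<comment> \<open>As \<open>(n + 2 - ?l) * ?l = 4\<close> with a positive first factor,
        \<open>x u < ?l\<close> yields \<open>(n + 2) * x u - 4 < ?l * x u\<close>.\<close>
      also have "\<dots> < ?l * x u"
      proof -
        have "(real n + 2 - ?l) * ?l = 4" using S_root_eq[OF n(2)] by (simp add: algebra_simps)
        moreover have "?l < real n + 2"
        proof (rule ccontr)
          assume "\<not> ?l < real n + 2"
          then have "(real n + 2 - ?l) * ?l \<le> 0" using l n6 by (intro mult_nonpos_nonneg) auto
          then show False using calculation by simp
        qed
        ultimately have "(real n + 2 - ?l) * (real n + 1 / 3) < 4"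
          using l mult_strict_left_mono[of "real n + 1 / 3" ?l "real n + 2 - ?l"] by simp
        moreover have "(real n - 1) * (real n + 1 / 3 + 3) = (real n + 2) * (real n + 1 / 3) - 4"
          by (simp add: field_simps)
        moreover have "x u = real n + 1 / 3" by (simp add: x_def)
        ultimately show ?thesis by (simp only: left_diff_distrib)
      qed
      finally show ?thesis using True by simp
    next
      case False
      then have vA: "v \<in> ?A" using u v by auto
      let ?m = "real (?h v)" and ?S = "\<Sum>w\<in>nb ?A v. ?h w"
      have "(\<Sum>w\<in>N v. x v + x w) = (x v + x u) + (\<Sum>w\<in>nb ?A v. x v + x w)"
        unfolding Nv[OF vA] by (rule sum.insert[OF finb unb])
      also have "(\<Sum>w\<in>nb ?A v. x v + x w) = (\<Sum>w\<in>nb ?A v. (x v + 1) + real (?h w))"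
        by (intro sum.cong) (auto simp: x_def nb_def)
      also have "\<dots> = ?m * (x v + 1) + real ?S" by (simp add: sum.distrib)
      finally have sum: "(\<Sum>w\<in>N v. x v + x w) = ?m * ?m + 3 * ?m + real n + 4 / 3 + real ?S"
        using False by (simp add: x_def algebra_simps)
      have le: "(real n + 4 / 3) * (?m + 1) < ?l * x v"
        using False mult_strict_right_mono[OF l, of "?m + 1"] by (simp add: x_def)
      have nbA: "w \<in> ?A" "(v, w) \<in> parcs G" if "w \<in> nb ?A v" for w
        using that by (auto simp: nb_def)
      \<comment> \<open>For \<open>?h v = 0\<close> both sides agree. Inside \<open>?A\<close>, the
        neighbour of a leaf may be a star centre, of degree at most \<open>n - 3\<close> by
        \<open>h\<close>; neighbours of a vertex of degree 2 have degree at most 2; those of a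
        larger star centre are leaves.\<close>
      consider "?h v = 0" | "?h v = 1" | "?h v = 2" | "?h v \<ge> 3" by linarith
      then have "?m * ?m + 3 * ?m + real n + 4 / 3 + real ?S \<le> (real n + 4 / 3) * (?m + 1)"
      proof cases
        case 1
        then show ?thesis using finb by simp
      next
        case 2
        have "?S \<le> (\<Sum>w\<in>nb ?A v. n - 3)" by (intro sum_mono h nbA)
        then have "?S \<le> n - 3" unfolding sum_constant 2 by simp
        then have "real ?S \<le> real (n - 3)" by (rule of_nat_mono)
        also have "\<dots> = real n - 3" using n(2) by (simp add: of_nat_diff)
        finally have "real ?S \<le> real n - 3" .
        then show ?thesis unfolding 2 by simp
      next
        case 3
        have "?S \<le> (\<Sum>w\<in>nb ?A v. 2)"
        proof (rule sum_mono)
          fix w assume w: "w \<in> nb ?A v"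
          show "?h w \<le> 2"
            using P4_free_edge_cases[OF P4 fin vA nbA[OF w]] 3 by auto
        qed
        then have "?S \<le> 4" unfolding sum_constant 3 by simp
        then have "real ?S \<le> real 4" by (rule of_nat_mono)
        then show ?thesis unfolding 3 using n6 by simp
      next
        case 4
        have "?S = (\<Sum>w\<in>nb ?A v. 1)" by (intro sum.cong refl leaf[OF _ 4 vA])
        then have S: "real ?S = ?m" by simp
        have "?m + 3 \<le> real n" using h[OF vA] n(2) by simp
        then have "?m * (?m + 4) \<le> ?m * (real n + 4 / 3)" by (intro mult_left_mono) auto
        then show ?thesis unfolding S by (simp add: algebra_simps)
      qed
      then show ?thesis using sum le by linarith
    qed
  qed
qed

section \<open>Strict bound for all non-extremal graphs\<close>

lemma signless_radius_less_S_root: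
  assumes hf: house_free and n: "card (pverts G) = n" "n \<ge> 6"
    and noS: "\<And>u v. \<not> S2_at u v"
  shows "signless_radius G < S_root n"
proof (cases "\<exists>u\<in>pverts G. N u = pverts G - {u}")
  case True
  then show ?thesis using signless_radius_dominating[OF hf _ _ n] noS by blast
next
  case False
  \<comment> \<open>Isolated vertices get 1 to keep the vector positive; their rows are empty sums,
    and they are nobody's neighbours.\<close>
  define x where "x v = (if d v = 0 then 1 else real (d v))" for v
  have l: "S_root n > real n + 4 / 3" by (rule S_root_gt[OF n(2)])
  show ?thesis
  proof (rule signless_radius_less)
    show "pverts G \<noteq> {}" using n by auto
    show "x v > 0" for v by (auto simp: x_def card_gt_0_iff)
    fix u assume u: "u \<in> pverts G"
    show "(\<Sum>v\<in>N u. x u + x v) < S_root n * x u"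
    proof (cases "d u = 0")
      case True
      then show ?thesis using l by (simp add: x_def)
    next
      case d0: False
      have "N u \<subseteq> pverts G - {u}" using adj_verts by auto
      then have "N u \<subset> pverts G - {u}" using False u by blast
      then have "d u < card (pverts G - {u})"
        using pair_finite_verts by (intro psubset_card_mono) auto
      then have "d u + 2 \<le> card (pverts G)" using u n by simp
      from house_free_sum_d[OF hf u this]
      have "real (3 * (d u * d u + (\<Sum>v\<in>N u. d v))) \<le> real ((3 * n + 4) * d u)"
        unfolding n(1) by (rule of_nat_mono)
      then have "real (d u) * real (d u) + (\<Sum>v\<in>N u. real (d v)) \<le> (real n + 4 / 3) * real (d u)"
        by (simp add: algebra_simps)
      also have "\<dots> < S_root n * real (d u)" using l d0 by (intro mult_strict_right_mono) auto
      also have "real (d u) * real (d u) + (\<Sum>v\<in>N u. real (d v)) = (\<Sum>v\<in>N u. x u + x v)"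
      proof -
        have "x v = real (d v)" if "v \<in> N u" for v
        proof -
          have "u \<in> N v" using that adj_sym by simp
          then have "d v \<noteq> 0" by (metis card_0_eq empty_iff finite_nb)
          then show ?thesis by (simp add: x_def)
        qed
        then have "(\<Sum>v\<in>N u. x v) = (\<Sum>v\<in>N u. real (d v))" by (intro sum.cong) auto
        then show ?thesis using d0 by (simp add: sum.distrib x_def)
      qed
      finally show ?thesis using d0 by (simp add: x_def)
    qed
  qed
qed

end


section \<open>Isomorphisms and subgraphs\<close>

lemma digraph_iso_pairI:
  assumes "pair_wf_digraph G" "inj_on f (pverts G)"
    and "pverts H = f ` pverts G" "parcs H = map_prod f f ` parcs G"
  shows "digraph_iso (with_proj G) (with_proj H)"
proof -
  interpret pair_wf_digraph G by fact
  let ?i = "\<lparr> iso_verts = f, iso_arcs = map_prod f f, iso_head = snd, iso_tail = fst \<rparr>"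
  have "inj_on (map_prod f f) (parcs G)"
    using map_prod_inj_on[OF assms(2,2)] by (rule inj_on_subset) (auto dest: wellformed')
  then have "pre_digraph.digraph_isomorphism (with_proj G) ?i"
    using assms(2) wf_digraph_wp_iff[of G] assms(1)
    by (auto simp: pre_digraph.digraph_isomorphism_def)
  moreover have "with_proj H = app_iso ?i (with_proj G)"
    by (simp add: with_proj_def app_iso_def assms(3,4))
  ultimately show ?thesis unfolding digraph_iso_def by blast
qed

text \<open>Tail and head in \<open>H\<close> are projections, so the arc map of \<open>i\<close>
  has to apply the vertex map to both ends.\<close>

lemma digraph_iso_pairE:
  assumes "digraph_iso (with_proj G) (with_proj H)"
  obtains f where "inj_on f (pverts G)" "pverts H = f ` pverts G" "parcs H = map_prod f f ` parcs G"
proof -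
  obtain i where i: "pre_digraph.digraph_isomorphism (with_proj G) i"
    and H: "with_proj H = app_iso i (with_proj G)"
    using assms unfolding digraph_iso_def by blast
  have ft: "iso_tail i = fst" "iso_head i = snd"
    and V: "pverts H = iso_verts i ` pverts G" and E: "parcs H = iso_arcs i ` parcs G"
    using H by (simp_all add: with_proj_def app_iso_def)
  have "iso_arcs i e = map_prod (iso_verts i) (iso_verts i) e" if "e \<in> parcs G" for e
    using i that ft by (auto simp: pre_digraph.digraph_isomorphism_def prod_eq_iff)
  then have "parcs H = map_prod (iso_verts i) (iso_verts i) ` parcs G" unfolding E by force
  then show ?thesis using that i V by (auto simp: pre_digraph.digraph_isomorphism_def)
qed

text \<open>The vertices 0 and 1, singled out by \<open>f w < 2\<close>, correspond to
  \<open>u\<close> and \<open>v\<close>; the others may be matched in any order.\<close>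

lemma (in pair_graph) digraph_iso_S_graph_iff:
  assumes n: "card (pverts G) = n" "n \<ge> 2"
  shows "digraph_iso (with_proj G) (with_proj (S_graph n 2)) \<longleftrightarrow> (\<exists>u v. S2_at u v)"
proof
  assume "digraph_iso (with_proj G) (with_proj (S_graph n 2))"
  then obtain f where f: "inj_on f (pverts G)" "{..<n} = f ` pverts G"
    "parcs (S_graph n 2) = map_prod f f ` parcs G"
    by (rule digraph_iso_pairE) (auto simp: S_graph_def)
  have "0 \<in> f ` pverts G" "1 \<in> f ` pverts G" using n(2) by (auto simp: f(2)[symmetric])
  then obtain u v where uv: "u \<in> pverts G" "f u = 0" "v \<in> pverts G" "f v = 1" by force
  have E: "(a, b) \<in> parcs G \<longleftrightarrow>
      a \<in> pverts G \<and> b \<in> pverts G \<and> a \<noteq> b \<and> (a \<in> {u, v} \<or> b \<in> {u, v})" for a b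
  proof (cases "a \<in> pverts G \<and> b \<in> pverts G")
    case True
    have iff: "f p = f q \<longleftrightarrow> p = q" if "p \<in> pverts G" "q \<in> pverts G" for p q
      using f(1) that by (auto dest: inj_onD)
    have lt: "f p < 2 \<longleftrightarrow> p \<in> {u, v}" if "p \<in> pverts G" for p
      using iff[OF that uv(1)] iff[OF that uv(3)] uv by (auto simp: less_2_cases_iff)
    have "(a, b) \<in> parcs G \<longleftrightarrow> (f a, f b) \<in> parcs (S_graph n 2)"
    proof
      assume "(f a, f b) \<in> parcs (S_graph n 2)"
      then obtain p q where "(p, q) \<in> parcs G" "f a = f p" "f b = f q" unfolding f(3) by auto
      then show "(a, b) \<in> parcs G" using iff True adj_verts by metis
    qed (force simp: f(3))
    also have "\<dots> \<longleftrightarrow> f a \<noteq> f b \<and> (f a < 2 \<or> f b < 2)"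
      using True f(2) by (auto simp: S_graph_def)
    also have "\<dots> \<longleftrightarrow> a \<noteq> b \<and> (a \<in> {u, v} \<or> b \<in> {u, v})"
      using iff lt True by auto
    finally show ?thesis using True by simp
  qed (use adj_verts in blast)
  have "S2_at u v" unfolding S2_at_def using uv E by auto
  then show "\<exists>u v. S2_at u v" by blast
next
  assume "\<exists>u v. S2_at u v"
  then obtain u v where S: "S2_at u v" by blast
  then have uv: "u \<in> pverts G" "v \<in> pverts G" "u \<noteq> v" by (auto simp: S2_at_def)
  have E: "\<And>a b. (a, b) \<in> parcs G \<longleftrightarrow>
      a \<in> pverts G \<and> b \<in> pverts G \<and> a \<noteq> b \<and> (a \<in> {u, v} \<or> b \<in> {u, v})"
    using S by (simp add: S2_at_def)
  let ?R = "pverts G - {u, v}"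
  have "card ?R = card {2..<n}" using uv n by (simp add: card_Diff_subset)
  then obtain g where g: "bij_betw g ?R {2..<n}"
    using finite_same_card_bij[of ?R "{2..<n}"] pair_finite_verts by auto
  define f where "f w = (if w = u then 0 else if w = v then 1 else g w)" for w
  have g2: "2 \<le> g w" "g w < n" if "w \<in> ?R" for w
    using bij_betwE[OF g] that by auto
  have lt: "f w < 2 \<longleftrightarrow> w = u \<or> w = v" if "w \<in> pverts G" for w
    using g2(1)[of w] that by (auto simp: f_def)
  have inj: "inj_on f (pverts G)"
  proof (rule inj_onI)
    fix a b assume ab: "a \<in> pverts G" "b \<in> pverts G" "f a = f b"
    show "a = b"
    proof (cases "f a < 2")
      case True
      then show ?thesis using ab lt[of a] lt[of b] uv(3) by (auto simp: f_def split: if_splits)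
    next
      case False
      then have "a \<in> ?R" "b \<in> ?R" using ab lt[of a] lt[of b] by auto
      moreover from this have "g a = g b" using ab(3) by (auto simp: f_def)
      ultimately show ?thesis using g by (auto simp: bij_betw_def dest: inj_onD)
    qed
  qed
  have img: "f ` pverts G = {..<n}"
  proof (rule card_seteq)
    show "f ` pverts G \<subseteq> {..<n}" using g2(2) n(2) by (auto simp: f_def)
    show "card {..<n} \<le> card (f ` pverts G)" using card_image[OF inj] n(1) by simp
  qed simp
  have iff: "f p = f q \<longleftrightarrow> p = q" if "p \<in> pverts G" "q \<in> pverts G" for p q
    using inj that by (auto dest: inj_onD)
  have "parcs (S_graph n 2) = map_prod f f ` parcs G"
  proof (rule subset_antisym; rule subsetI)
    fix e assume e: "e \<in> parcs (S_graph n 2)"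
    obtain i j where ij: "e = (i, j)" by fastforce
    then have "i \<in> f ` pverts G" "j \<in> f ` pverts G" using e unfolding img by (auto simp: S_graph_def)
    then obtain a b where ab: "a \<in> pverts G" "i = f a" "b \<in> pverts G" "j = f b" by blast
    then have "(a, b) \<in> parcs G" using e ij lt unfolding E by (auto simp: S_graph_def)
    then show "e \<in> map_prod f f ` parcs G" using ij ab by force
  next
    fix e assume "e \<in> map_prod f f ` parcs G"
    then obtain a b where ab: "e = (f a, f b)" "(a, b) \<in> parcs G" by auto
    then have "f a \<in> {..<n}" "f b \<in> {..<n}" unfolding img[symmetric] using adj_verts by auto
    then show "e \<in> parcs (S_graph n 2)"
      using ab lt iff unfolding E by (auto simp: S_graph_def)
  qed
  then show "digraph_iso (with_proj G) (with_proj (S_graph n 2))"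
    using inj img by (intro digraph_iso_pairI[of G f]) (auto simp: S_graph_def pair_wf_digraph)
qed

section \<open>Transfer to \<open>S_graph\<close> and \<open>theta_graph\<close>, and
  conclusion\<close>

lemma signless_radius_S_graph:
  assumes "n \<ge> 6"
  shows "signless_radius (S_graph n 2) = S_root n"
proof -
  interpret S: pair_graph "S_graph n 2" by (rule pair_graph_S_graph)
  have "S.S2_at 0 1" unfolding S.S2_at_def using assms by (auto simp: S_graph_def)
  then show ?thesis using assms by (intro S.signless_radius_S2) (auto simp: S_graph_def)
qed

lemma (in pair_graph) house_free_if_no_theta:
  assumes "\<not> contains_subgraph G (theta_graph 1 2 3)"
  shows house_free
  unfolding house_free_def
proof (rule notI, elim exE conjE)
  fix s t a b c
  assume dist: "distinct [s, t, a, b, c]"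
    and E: "(s, t) \<in> parcs G" "(s, a) \<in> parcs G" "(a, t) \<in> parcs G"
      "(s, b) \<in> parcs G" "(b, c) \<in> parcs G" "(c, t) \<in> parcs G"
  let ?T = "theta_graph 1 2 3"
  \<comment> \<open>The chord \<open>st\<close> is the path of length 1, without inner vertices;
    \<open>a\<close> is the middle of the path of length 2, and \<open>b\<close>, \<open>c\<close>
    follow \<open>s\<close> on the path of length 3.\<close>
  define f where "f z = (case z of Source \<Rightarrow> s | Sink \<Rightarrow> t
    | Inner i j \<Rightarrow> if i = 1 then a else if j = 1 then b else c)" for z
  define H where "H = \<lparr> pverts = f ` pverts ?T, parcs = map_prod f f ` parcs ?T \<rparr>"
  note T_eq = theta_graph_1_2_3[unfolded One_nat_def]
  have T: "pair_wf_digraph ?T" by unfold_locales (auto simp: T_eq)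
  have inj: "inj_on f (pverts ?T)"
    using dist by (auto simp: T_eq f_def inj_on_def)
  have "pair_wf_digraph H"
    using pair_wf_digraph.wellformed'[OF T] by unfold_locales (auto simp: H_def)
  moreover have "pverts H \<subseteq> pverts G"
    using E adj_verts by (auto simp: H_def T_eq f_def)
  moreover have "parcs H \<subseteq> parcs G"
    using E adj_sym by (auto simp: H_def T_eq f_def)
  ultimately have "subgraph (with_proj H) (with_proj G)"
    using pair_wf_digraph by (simp add: subgraph_def compatible_def wf_digraph_wp_iff)
  moreover have "digraph_iso (with_proj ?T) (with_proj H)"
    using T inj by (rule digraph_iso_pairI) (simp_all add: H_def)
  ultimately show False using assms unfolding contains_subgraph_def by blast
qed

theorem theorem1p3:
  fixes G :: "'a pair_pre_digraph" and n :: nat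
  assumes "pair_graph G"
    and "card (pverts G) = n"
    and "n \<ge> 6"
    and "\<not> contains_subgraph G (theta_graph 1 2 3)"
  shows "signless_radius G \<le> signless_radius (S_graph n 2)
    \<and> (signless_radius G = signless_radius (S_graph n 2)
        \<longleftrightarrow> digraph_iso (with_proj G) (with_proj (S_graph n 2)))"
proof -
  interpret pair_graph G by fact
  have hf: house_free using assms(4) by (rule house_free_if_no_theta)
  have iso: "digraph_iso (with_proj G) (with_proj (S_graph n 2)) \<longleftrightarrow> (\<exists>u v. S2_at u v)"
    using assms(2,3) by (intro digraph_iso_S_graph_iff) auto
  show ?thesis
  \<comment> \<open>Outside the extremal case the inequality is strict, which settles the bound and
    the equality statement at once.\<close>
  proof (cases "\<exists>u v. S2_at u v")
    case True
    then show ?thesis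
      using signless_radius_S2 assms(2,3) iso by (auto simp: signless_radius_S_graph)
  next
    case False
    then have "signless_radius G < S_root n"
      using signless_radius_less_S_root[OF hf assms(2,3)] by blast
    then show ?thesis using False iso signless_radius_S_graph[OF assms(3)] by auto
  qed
qed

end
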